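(* Let $(\mathfrak T,\mathfrak A)$ be an adequate context in which the operator $\mathfrak A$ is suitable. Then, for any $X\in\mathfrak T$, the following are equivalent. (i) $\mathbb A(X)$ is Hurewicz. (ii) $\mathbb A(X)\models \mathsf S_{\mathrm{fin}}(\mathcal O(\mathfrak A),\mathcal O^{\mathrm{gp}}(\mathfrak A))$. (iii) $X\models \mathsf S_{\mathrm{fin}}(\mathcal O(\mathfrak A),\mathcal O^{\mathrm{gp}}(\mathfrak A))$. (iv) $X\models \mathsf S_{\mathrm{fin}}(\mathcal O(\mathfrak A),\mathcal O(\mathfrak A))$ and $\mathcal O_X^{\mathrm{gp}}(\mathfrak A_X)=\mathcal O_X(\mathfrak A_X)\cap[\mathscr T_X]^\omega$.
   Context: All spaces are Hausdorff topological spaces. For a set $Y$, $[Y]^{<\omega}$ is the set of non-empty finite subsets of $Y$ and $[Y]^{\omega}$ is the set of countably infinite subsets of $Y$. $K(X)$ is the set of non-empty compact subsets of $X$. $\mathscr T_X$ is the set of open $U\subseteq X$ with $U\neq\emptyset$ and $U\neq X$. $\mathcal O_X$ is the set of (non-trivial) open covers of $X$: all $\mathscr U\subseteq\mathscr T_X$ with $\bigcup\mathscr U=X$. $\mathbb K(X)$ is $K(X)$ with the Vietoris topology, generated by the sets $\{K: K\subseteq U\}$ and $\{K: K\cap U\neq\emptyset\}$ for $U\subseteq X$ open. An ideal of closed sets of $X$ is a collection $\mathcal A$ of proper closed subsets of $X$ with $[X]^{<\omega}\subseteq\mathcal A$ such that: if $A,B\in\mathcal A$ and $A\cup B\neq X$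 then $A\cup B\in\mathcal A$; and if $A\in\mathcal A$ and $B\subseteq A$ is closed and non-empty then $B\in\mathcal A$. It is an ideal of compact sets if moreover $\mathcal A\subseteq K(X)$. For an ideal $\mathcal A$ of closed sets, $\mathcal O_X(\mathcal A)$ is the set of all $\mathscr U\in\mathcal O_X$ such that for every $A\in\mathcal A$ there is $U\in\mathscr U$ with $A\subseteq U$. For a class $\mathfrak C$, $\mathscr C\in\mathfrak C$ is groupable if there is $\phi:\mathscr C\to\omega$ with every $\phi^{-1}(n)$ finite and with $\bigcup\{\phi^{-1}(n):n\in J\}\in\mathfrak C$ for every infinite $J\subseteq\omega$. $\mathfrak C^{\mathrm{gp}}$ denotes the set of groupable members of $\mathfrak C$; thus $\mathcal O_X^{\mathrm{gp}}(\mathcal A)$ is the set of groupable members of $\mathcal O_X(\mathcal A)$. Selection principles: for collections $\mathcal C,\mathcal D$, $\mathsf S_{\mathrm{fin}}(\mathcal C,\mathcal D)$ says that for every sequence $\langle\mathscr U_n:n\in\omega\rangle$ in $\mathcal C$ there are $\mathscr F_n\in[\mathscr U_n]^{<\omega}$ with $\bigcup_n\mathscr F_n\in\mathcal D$. A topological operator is a function assigning to each topological space a collection of sets related to its topological structure; when the arguments of a selection principle are topological operators, $Z\models\mathsf S_{\mathrm{fin}}(\cdot,\cdot)$ means the principle for the collections those operators assign to $Z$. A space $Z$ is Menger if $Z\models\mathsf S_{\mathrm{fin}}(\mathcal O,\mathcal O)$. $Z$ is Hurewicz if for every sequence $\langle\mathscr U_n\rangle$ in $\mathcal O_Z$ there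 are $\mathscr F_n\in[\mathscr U_n]^{<\omega}$ such that for every $z\in Z$ there is $m$ with $z\in\bigcup\mathscr F_n$ for all $n\geq m$. A pair $(\mathfrak T,\mathfrak A)$ is an adequate context if $\mathfrak T$ is a class of topological spaces, $\mathfrak A$ is a topological operator, and for every $X\in\mathfrak T$: $\mathfrak A_X$ is an ideal of compact subsets of $X$, and $\mathbb A(X)\in\mathfrak T$, where $\mathbb A(X)$ is the set $\mathfrak A_X$ with the subspace topology from $\mathbb K(X)$. Write $[U]=\{K\in\mathbb A(X):K\subseteq U\}$ for open non-empty $U\subseteq X$. $\mathcal O(\mathfrak A)$ is the operator $X\mapsto\mathcal O_X(\mathfrak A_X)$, and $\mathcal O^{\mathrm{gp}}(\mathfrak A)$ is the operator $X\mapsto\mathcal O_X^{\mathrm{gp}}(\mathfrak A_X)$. Given an adequate context, $\mathfrak A$ is suitable if for every $X\in\mathfrak T$: (S1) for each $K_0\in\mathfrak A_X$, $\{K\in\mathbb A(X):K\subseteq K_0\}\in\mathfrak A_{\mathbb A(X)}$, and for each $\mathbf K\in\mathfrak A_{\mathbb A(X)}$, $\bigcup\mathbf K\in\mathfrak A_X$; (S2) for every $\mathscr U\in\mathcal O_X(\mathfrak A_X)$, $\{[U]:U\in\mathscr U\}\in\mathcal O_{\mathbb A(X)}(\mathfrak A_{\mathbb A(X)})$; (S3) for every $\mathscr U\in\mathcal O_{\mathbb A(X)}(\mathfrak A_{\mathbb A(X)})$, $\{V\in\mathscr T_X:(\exists U\in\mathscr U)\ [V]\subseteq U\}\in\mathcal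 O_X(\mathfrak A_X)$; (S4) if $X\models\mathsf S_{\mathrm{fin}}(\mathcal O(\mathfrak A),\mathcal O^{\mathrm{gp}}(\mathfrak A))$ then $X$ is Hurewicz; (S5) the following are equivalent: $\mathbb A(X)$ is Menger; $\mathbb A(X)\models\mathsf S_{\mathrm{fin}}(\mathcal O(\mathfrak A),\mathcal O(\mathfrak A))$; $X\models\mathsf S_{\mathrm{fin}}(\mathcal O(\mathfrak A),\mathcal O(\mathfrak A))$. *)

theory Defs
  imports "HOL-Analysis.Analysis"
begin

definition fin_subsets :: "'a set \<Rightarrow> 'a set set" where
  "fin_subsets Y = {F. F \<subseteq> Y \<and> finite F \<and> F \<noteq> {}}"

definition ctbl_subsets :: "'a set \<Rightarrow> 'a set set" where
  "ctbl_subsets Y = {C. C \<subseteq> Y \<and> countable C \<and> infinite C}"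

definition nt_opens :: "'a topology \<Rightarrow> 'a set set" where
  "nt_opens X = {U. openin X U \<and> U \<noteq> {} \<and> U \<noteq> topspace X}"

definition covers :: "'a topology \<Rightarrow> 'a set set set" where
  "covers X = {\<U>. \<U> \<subseteq> nt_opens X \<and> \<Union>\<U> = topspace X}"

definition ideal_covers :: "'a topology \<Rightarrow> 'a set set \<Rightarrow> 'a set set set" where
  "ideal_covers X \<A> = {\<U> \<in> covers X. \<forall>A\<in>\<A>. \<exists>U\<in>\<U>. A \<subseteq> U}"

definition ideal_of_closed_sets :: "'a topology \<Rightarrow> 'a set set \<Rightarrow> bool" where
  "ideal_of_closed_sets X \<A> \<longleftrightarrow>
     (\<forall>A\<in>\<A>. closedin X A \<and> A \<noteq> topspace X) \<and>
     fin_subsets (topspace X) \<subseteq> \<A> \<and>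
     (\<forall>A\<in>\<A>. \<forall>B\<in>\<A>. A \<union> B \<noteq> topspace X \<longrightarrow> A \<union> B \<in> \<A>) \<and>
     (\<forall>A\<in>\<A>. \<forall>B. B \<subseteq> A \<and> closedin X B \<and> B \<noteq> {} \<longrightarrow> B \<in> \<A>)"

definition compacts :: "'a topology \<Rightarrow> 'a set set" where
  "compacts X = {K. compactin X K \<and> K \<noteq> {}}"

definition ideal_of_compact_sets :: "'a topology \<Rightarrow> 'a set set \<Rightarrow> bool" where
  "ideal_of_compact_sets X \<A> \<longleftrightarrow> ideal_of_closed_sets X \<A> \<and> \<A> \<subseteq> compacts X"

text \<open>The values of \<open>\<phi>\<close> outside \<open>C\<close> are irrelevant: \<open>\<phi> -` {n} \<inter> C\<close> is the fibre of the
  restriction of \<open>\<phi>\<close> to \<open>C\<close>.\<close>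
definition groupable :: "'a set set \<Rightarrow> 'a set \<Rightarrow> bool" where
  "groupable \<CC> C \<longleftrightarrow>
     (\<exists>\<phi> :: 'a \<Rightarrow> nat. (\<forall>n. finite (\<phi> -` {n} \<inter> C)) \<and>
        (\<forall>J. infinite J \<longrightarrow> (\<Union>n\<in>J. \<phi> -` {n} \<inter> C) \<in> \<CC>))"

definition gp :: "'a set set \<Rightarrow> 'a set set" where
  "gp \<CC> = {C \<in> \<CC>. groupable \<CC> C}"

definition S_fin :: "'a set set \<Rightarrow> 'a set set \<Rightarrow> bool" where
  "S_fin \<C> \<D> \<longleftrightarrow>
     (\<forall>\<U> :: nat \<Rightarrow> 'a set. (\<forall>n. \<U> n \<in> \<C>) \<longrightarrow>
        (\<exists>\<F>. (\<forall>n. \<F> n \<in> fin_subsets (\<U> n)) \<and> (\<Union>n. \<F> n) \<in> \<D>))"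

definition models_S_fin ::
    "'a topology \<Rightarrow> ('a topology \<Rightarrow> 'b set set) \<Rightarrow> ('a topology \<Rightarrow> 'b set set) \<Rightarrow> bool" where
  "models_S_fin Z \<C> \<D> \<longleftrightarrow> S_fin (\<C> Z) (\<D> Z)"

definition Menger_space :: "'a topology \<Rightarrow> bool" where
  "Menger_space Z \<longleftrightarrow> models_S_fin Z covers covers"

definition Hurewicz_space :: "'a topology \<Rightarrow> bool" where
  "Hurewicz_space Z \<longleftrightarrow>
     (\<forall>\<U> :: nat \<Rightarrow> 'a set set. (\<forall>n. \<U> n \<in> covers Z) \<longrightarrow>
        (\<exists>\<F>. (\<forall>n. \<F> n \<in> fin_subsets (\<U> n)) \<and>
             (\<forall>z\<in>topspace Z. \<exists>m. \<forall>n\<ge>m. z \<in> \<Union>(\<F> n))))"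

definition op_covers :: "('a topology \<Rightarrow> 'a set set) \<Rightarrow> 'a topology \<Rightarrow> 'a set set set" where
  "op_covers \<AA> X = ideal_covers X (\<AA> X)"

definition op_covers_gp :: "('a topology \<Rightarrow> 'a set set) \<Rightarrow> 'a topology \<Rightarrow> 'a set set set" where
  "op_covers_gp \<AA> X = gp (ideal_covers X (\<AA> X))"

definition vietoris :: "'a topology \<Rightarrow> 'a set topology" where
  "vietoris X = topology_generated_by
     ({{K \<in> compacts X. K \<subseteq> U} | U. openin X U} \<union>
      {{K \<in> compacts X. K \<inter> U \<noteq> {}} | U. openin X U})"

lemma topspace_vietoris: "topspace (vietoris X) = compacts X"
proof (rule equalityI)
  have "{K \<in> compacts X. K \<subseteq> topspace X} = compacts X"
    by (auto simp: compacts_def dest: compactin_subset_topspace)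
  then show "compacts X \<subseteq> topspace (vietoris X)"
    unfolding vietoris_def topology_generated_by_topspace
    by (intro Union_upper UnI1 CollectI exI[of _ "topspace X"]) auto
  show "topspace (vietoris X) \<subseteq> compacts X"
    unfolding vietoris_def topology_generated_by_topspace by (rule Union_least) auto
qed

text \<open>
  A space and its hyperspace must belong to the same class of spaces, whereas in HOL the points of
  a hyperspace over \<open>'u\<close> have type \<open>'u set\<close>. So \<open>'u\<close> plays the role of the universe: all spaces
  are topologies on subsets of \<open>'u\<close>, and \<open>c X\<close>, which is required to be injective on \<open>\<AA> X\<close>,
  says which element of \<open>'u\<close> the set \<open>K \<in> \<AA> X\<close> is when regarded as a point.
  If \<open>'u\<close> is a universe of sets in the sense of ZFC, \<open>c X\<close> is the identification of a set of
  points with an element of the universe. The space \<open>hyper \<AA> c X\<close> is the subspace \<open>\<AA> X\<close> of the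
  Vietoris space, with its points replaced by their codes.
\<close>
definition hyper ::
    "('u topology \<Rightarrow> 'u set set) \<Rightarrow> ('u topology \<Rightarrow> 'u set \<Rightarrow> 'u) \<Rightarrow> 'u topology \<Rightarrow> 'u topology" where
  "hyper \<AA> c X = pullback_topology (c X ` \<AA> X) (inv_into (\<AA> X) (c X))
                   (subtopology (vietoris X) (\<AA> X))"

lemma homeomorphic_map_hyper:
  assumes "\<AA> X \<subseteq> compacts X" "inj_on (c X) (\<AA> X)"
  shows "homeomorphic_map (subtopology (vietoris X) (\<AA> X)) (hyper \<AA> c X) (c X)"
proof -
  let ?S = "subtopology (vietoris X) (\<AA> X)" and ?d = "inv_into (\<AA> X) (c X)"
  have ts: "topspace ?S = \<AA> X"
    using assms(1) by (auto simp: topspace_vietoris)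
  have "continuous_map ?S ?S (?d \<circ> c X)"
    by (rule continuous_map_eq[OF continuous_map_id]) (use assms(2) ts in auto)
  then have "continuous_map ?S (hyper \<AA> c X) (c X)"
    unfolding hyper_def by (rule continuous_map_pullback') (use ts in auto)
  moreover have "continuous_map (hyper \<AA> c X) ?S ?d"
    unfolding hyper_def using continuous_map_pullback[OF continuous_map_id] by simp
  moreover have "topspace (hyper \<AA> c X) = c X ` \<AA> X"
    unfolding hyper_def topspace_pullback_topology ts using inv_into_into[of _ "c X" "\<AA> X"] by auto
  ultimately have "homeomorphic_maps ?S (hyper \<AA> c X) (c X) ?d"
    using assms(2) ts by (auto simp: homeomorphic_maps_def)
  then show ?thesis
    by (rule homeomorphic_maps_imp_map)
qed

text \<open>The set of points \<open>K\<close> of the hyperspace with \<open>K \<subseteq> S\<close>; for open \<open>S\<close> this is \<open>[S]\<close>.\<close>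
definition below ::
    "('u topology \<Rightarrow> 'u set set) \<Rightarrow> ('u topology \<Rightarrow> 'u set \<Rightarrow> 'u) \<Rightarrow> 'u topology \<Rightarrow> 'u set \<Rightarrow> 'u set" where
  "below \<AA> c X S = c X ` {K \<in> \<AA> X. K \<subseteq> S}"

text \<open>The union of a set \<open>P\<close> of points of the hyperspace.\<close>
definition union_of_points ::
    "('u topology \<Rightarrow> 'u set set) \<Rightarrow> ('u topology \<Rightarrow> 'u set \<Rightarrow> 'u) \<Rightarrow> 'u topology \<Rightarrow> 'u set \<Rightarrow> 'u set" where
  "union_of_points \<AA> c X P = \<Union>{K \<in> \<AA> X. c X K \<in> P}"

definition adequate_context ::
    "'u topology set \<Rightarrow> ('u topology \<Rightarrow> 'u set set) \<Rightarrow> ('u topology \<Rightarrow> 'u set \<Rightarrow> 'u) \<Rightarrow> bool" where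
  "adequate_context \<TT> \<AA> c \<longleftrightarrow>
     (\<forall>X\<in>\<TT>. Hausdorff_space X \<and>
             ideal_of_compact_sets X (\<AA> X) \<and>
             inj_on (c X) (\<AA> X) \<and>
             hyper \<AA> c X \<in> \<TT>)"

definition suitable ::
    "'u topology set \<Rightarrow> ('u topology \<Rightarrow> 'u set set) \<Rightarrow> ('u topology \<Rightarrow> 'u set \<Rightarrow> 'u) \<Rightarrow> bool" where
  "suitable \<TT> \<AA> c \<longleftrightarrow>
     (\<forall>X\<in>\<TT>.
        (\<forall>K\<^sub>0\<in>\<AA> X. below \<AA> c X K\<^sub>0 \<in> \<AA> (hyper \<AA> c X)) \<and>
        (\<forall>P\<in>\<AA> (hyper \<AA> c X). union_of_points \<AA> c X P \<in> \<AA> X) \<and>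
        (\<forall>\<U>\<in>op_covers \<AA> X. below \<AA> c X ` \<U> \<in> op_covers \<AA> (hyper \<AA> c X)) \<and>
        (\<forall>\<U>\<in>op_covers \<AA> (hyper \<AA> c X).
            {V \<in> nt_opens X. \<exists>U\<in>\<U>. below \<AA> c X V \<subseteq> U} \<in> op_covers \<AA> X) \<and>
        (models_S_fin X (op_covers \<AA>) (op_covers_gp \<AA>) \<longrightarrow> Hurewicz_space X) \<and>
        (Menger_space (hyper \<AA> c X)
           \<longleftrightarrow> models_S_fin (hyper \<AA> c X) (op_covers \<AA>) (op_covers \<AA>)) \<and>
        (models_S_fin (hyper \<AA> c X) (op_covers \<AA>) (op_covers \<AA>)
           \<longleftrightarrow> models_S_fin X (op_covers \<AA>) (op_covers \<AA>)))"

end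

theory Submission
  imports Defs
begin

text \<open>
  All four conditions are compared with one selection property of an ideal \<open>\<A>\<close>, called
  \<open>cofinite_selection\<close> below: from every sequence of ideal covers one can choose finite sets
  \<open>F n\<close> such that each member of \<open>\<A>\<close> lies inside a single element of \<open>F n\<close> for all but finitely
  many \<open>n\<close>. It is the Hurewicz property with points replaced by members of \<open>\<A>\<close>, so it is
  just what the Hurewicz property of the hyperspace says about covers of the form \<open>{[U] : U \<in> \<U>}\<close>.

  Suitability forces \<open>\<A>\<close> to be closed under all finite unions, because a finite set of points
  of the hyperspace belongs to the ideal there, and its union must then belong to \<open>\<A>\<close>
  (\<open>additive_ideal_of_suitable\<close>). For such ideals one may delete finitely many elements from
  an ideal cover (\<open>ideal_covers_Diff_finite\<close>), and this makes cofinite selection equivalent to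
  \<open>S_fin\<close> from ideal covers to groupable ideal covers
  (\<open>S_fin_gp_iff_cofinite_selection\<close>). One direction passes to common refinements of the first
  \<open>n\<close> covers; the other has to make the chosen finite sets pairwise disjoint, and does so by
  making a choice in advance for every finite set of elements that might have to be avoided.

  The conditions are then linked as follows. If the hyperspace is Hurewicz, \<open>X\<close> has cofinite
  selection. This property passes from \<open>X\<close> to its hyperspace, since an ideal cover there is
  refined by sets \<open>[V]\<close> whose \<open>V\<close> form an ideal cover of \<open>X\<close>. The hyperspace is again a space
  of the class, so the groupable selection principle for it gives back the Hurewicz property.
  Finally, the principle for \<open>X\<close> splits into ordinary selection and groupability of countable
  ideal covers, because a countable ideal cover that contains a groupable one is groupable.
\<close>

section \<open>Ideals closed under finite unions\<close>

locale additive_ideal =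
  fixes X :: "'a topology" and \<A> :: "'a set set"
  assumes finite_sets: "fin_subsets (topspace X) \<subseteq> \<A>"
    and empty_notin: "{} \<notin> \<A>"
    and Un_closed: "A \<in> \<A> \<Longrightarrow> B \<in> \<A> \<Longrightarrow> A \<union> B \<in> \<A>"
begin

lemma ideal_coversI:
  assumes "\<U> \<subseteq> nt_opens X" "\<And>A. A \<in> \<A> \<Longrightarrow> \<exists>U\<in>\<U>. A \<subseteq> U"
  shows "\<U> \<in> ideal_covers X \<A>"
proof -
  have "x \<in> \<Union>\<U>" if "x \<in> topspace X" for x
  proof -
    have "{x} \<in> \<A>"
      using finite_sets that by (auto simp: fin_subsets_def)
    with assms(2) show ?thesis
      by blast
  qed
  moreover have "\<Union>\<U> \<subseteq> topspace X"
    using assms(1) by (auto simp: nt_opens_def dest: openin_subset)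
  ultimately show ?thesis
    using assms by (auto simp: ideal_covers_def covers_def)
qed

lemma ideal_covers_mono:
  assumes "\<U> \<in> ideal_covers X \<A>" "\<U> \<subseteq> \<V>" "\<V> \<subseteq> nt_opens X"
  shows "\<V> \<in> ideal_covers X \<A>"
  using assms by (intro ideal_coversI) (auto simp: ideal_covers_def, blast)

text \<open>Each deleted element misses some point; adding these points to a member of the ideal
  forces the element that contains the enlarged set to be one of those kept.\<close>

lemma ideal_covers_Diff_finite:
  assumes "\<U> \<in> ideal_covers X \<A>" "finite \<G>"
  shows "\<U> - \<G> \<in> ideal_covers X \<A>"
proof (rule ideal_coversI)
  have op: "\<U> \<subseteq> nt_opens X"
    using assms(1) by (auto simp: ideal_covers_def covers_def)
  then show "\<U> - \<G> \<subseteq> nt_opens X"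
    by blast
  fix A assume A: "A \<in> \<A>"
  have "\<exists>x. x \<in> topspace X - U" if "U \<in> \<G> \<inter> \<U>" for U
    using that op by (auto simp: nt_opens_def dest: openin_subset)
  then obtain p where p: "\<And>U. U \<in> \<G> \<inter> \<U> \<Longrightarrow> p U \<in> topspace X - U"
    by metis
  have "A \<union> p ` (\<G> \<inter> \<U>) \<in> \<A>"
  proof (cases "\<G> \<inter> \<U> = {}")
    case False
    with p assms(2) have "p ` (\<G> \<inter> \<U>) \<in> fin_subsets (topspace X)"
      by (auto simp: fin_subsets_def)
    with A finite_sets Un_closed show ?thesis
      by blast
  qed (use A in simp)
  then obtain U where "U \<in> \<U>" "A \<union> p ` (\<G> \<inter> \<U>) \<subseteq> U"
    using assms(1) unfolding ideal_covers_def by blast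
  moreover from this p have "U \<notin> \<G>"
    by blast
  ultimately show "\<exists>U\<in>\<U> - \<G>. A \<subseteq> U"
    by blast
qed

text \<open>A finite ideal cover would leave the empty family after deletion of all its elements, and
  nothing can be selected from the empty family.\<close>

lemma infinite_ideal_cover:
  assumes "S_fin (ideal_covers X \<A>) \<D>" "\<U> \<in> ideal_covers X \<A>"
  shows "infinite \<U>"
proof
  assume "finite \<U>"
  then have "{} \<in> ideal_covers X \<A>"
    using ideal_covers_Diff_finite[OF assms(2), of \<U>] by simp
  with assms(1) obtain \<F> :: "nat \<Rightarrow> 'a set set" where "\<forall>n. \<F> n \<in> fin_subsets {}"
    unfolding S_fin_def by (elim allE[of _ "\<lambda>_. {}"]) blast
  then show False
    by (auto simp: fin_subsets_def)
qed

section \<open>Groupable ideal covers\<close>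

lemma countable_gp:
  assumes "\<U> \<in> gp \<CC>"
  shows "countable \<U>"
proof -
  obtain \<phi> :: "'b \<Rightarrow> nat" where "\<And>n. finite (\<phi> -` {n} \<inter> \<U>)"
    using assms unfolding gp_def groupable_def by blast
  then have "countable (\<Union>n. \<phi> -` {n} \<inter> \<U>)"
    by (intro countable_UN[OF _ countable_finite]) simp_all
  moreover have "\<U> = (\<Union>n. \<phi> -` {n} \<inter> \<U>)"
    by blast
  ultimately show ?thesis
    by simp
qed

text \<open>The additional elements are countably many, so they can be distributed over the groups
  with at most one going to each.\<close>

lemma gp_mono:
  assumes "\<F> \<in> gp (ideal_covers X \<A>)" "\<F> \<subseteq> \<U>" "\<U> \<in> ideal_covers X \<A>" "countable \<U>"
  shows "\<U> \<in> gp (ideal_covers X \<A>)"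
proof -
  obtain \<phi> :: "'a set \<Rightarrow> nat"
    where fin: "\<And>n. finite (\<phi> -` {n} \<inter> \<F>)"
      and grp: "\<And>J. infinite J \<Longrightarrow> (\<Union>n\<in>J. \<phi> -` {n} \<inter> \<F>) \<in> ideal_covers X \<A>"
    using assms(1) unfolding gp_def groupable_def by blast
  define \<psi> where "\<psi> U = (if U \<in> \<F> then \<phi> U else to_nat_on \<U> U)" for U
  have "finite (\<psi> -` {n} \<inter> \<U>)" for n
  proof (rule finite_subset)
    show "\<psi> -` {n} \<inter> \<U> \<subseteq> (\<phi> -` {n} \<inter> \<F>) \<union> (to_nat_on \<U> -` {n} \<inter> \<U>)"
      by (auto simp: \<psi>_def split: if_splits)
    have "finite (to_nat_on \<U> -` {n} \<inter> \<U>)"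
      using assms(4) by (intro finite_vimage_IntI) auto
    then show "finite ((\<phi> -` {n} \<inter> \<F>) \<union> (to_nat_on \<U> -` {n} \<inter> \<U>))"
      using fin by simp
  qed
  moreover have "(\<Union>n\<in>J. \<psi> -` {n} \<inter> \<U>) \<in> ideal_covers X \<A>" if "infinite J" for J
  proof (rule ideal_covers_mono[OF grp[OF that]])
    show "(\<Union>n\<in>J. \<phi> -` {n} \<inter> \<F>) \<subseteq> (\<Union>n\<in>J. \<psi> -` {n} \<inter> \<U>)"
      using assms(2) by (auto simp: \<psi>_def)
    show "(\<Union>n\<in>J. \<psi> -` {n} \<inter> \<U>) \<subseteq> nt_opens X"
      using assms(3) by (auto simp: ideal_covers_def covers_def)
  qed
  ultimately show ?thesis
    using assms(3) unfolding gp_def groupable_def by blast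
qed

lemma S_fin_gp_iff_countable_groupable:
  "S_fin (ideal_covers X \<A>) (gp (ideal_covers X \<A>)) \<longleftrightarrow>
     S_fin (ideal_covers X \<A>) (ideal_covers X \<A>) \<and>
     gp (ideal_covers X \<A>) = ideal_covers X \<A> \<inter> ctbl_subsets (nt_opens X)"
  (is "S_fin ?O (gp ?O) \<longleftrightarrow> _ \<and> _ = ?C")
proof
  assume L: "S_fin ?O (gp ?O)"
  have gp_le: "gp ?O \<subseteq> ?O"
    by (auto simp: gp_def)
  have "S_fin ?O ?O"
    using L gp_le unfolding S_fin_def by blast
  moreover have "gp ?O \<subseteq> ?C"
    using gp_le infinite_ideal_cover[OF L] countable_gp
    by (auto simp: ctbl_subsets_def ideal_covers_def covers_def)
  moreover have "\<U> \<in> gp ?O" if \<U>: "\<U> \<in> ?C" for \<U>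
  proof -
    obtain \<F> :: "nat \<Rightarrow> 'a set set"
      where "\<And>n. \<F> n \<in> fin_subsets \<U>" "(\<Union>n. \<F> n) \<in> gp ?O"
      using L \<U> unfolding S_fin_def by (elim allE[of _ "\<lambda>_. \<U>"]) blast
    moreover from this have "(\<Union>n. \<F> n) \<subseteq> \<U>"
      unfolding fin_subsets_def by blast
    ultimately show ?thesis
      using \<U> by (auto simp: ctbl_subsets_def intro: gp_mono[of "\<Union>n. \<F> n"])
  qed
  ultimately show "S_fin ?O ?O \<and> gp ?O = ?C"
    by blast
next
  assume R: "S_fin ?O ?O \<and> gp ?O = ?C"
  show "S_fin ?O (gp ?O)"
    unfolding S_fin_def
  proof (intro allI impI)
    fix \<U> :: "nat \<Rightarrow> 'a set set" assume "\<forall>n. \<U> n \<in> ?O"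
    then obtain \<F> where \<F>: "\<forall>n. \<F> n \<in> fin_subsets (\<U> n)" "(\<Union>n. \<F> n) \<in> ?O"
      using R unfolding S_fin_def by blast
    have "countable (\<Union>n. \<F> n)"
      using \<F>(1) by (simp add: fin_subsets_def countable_finite)
    moreover have "infinite (\<Union>n. \<F> n)"
      using infinite_ideal_cover R \<F>(2) by blast
    ultimately have "(\<Union>n. \<F> n) \<in> ?C"
      using \<F>(2) by (auto simp: ctbl_subsets_def ideal_covers_def covers_def)
    with R \<F>(1) show "\<exists>\<F>. (\<forall>n. \<F> n \<in> fin_subsets (\<U> n)) \<and> (\<Union>n. \<F> n) \<in> gp ?O"
      by blast
  qed
qed

end

section \<open>Cofinite selection\<close>

definition cofinite_selection :: "'a topology \<Rightarrow> 'a set set \<Rightarrow> bool" where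
  "cofinite_selection X \<A> \<longleftrightarrow>
     (\<forall>\<U> :: nat \<Rightarrow> 'a set set. (\<forall>n. \<U> n \<in> ideal_covers X \<A>) \<longrightarrow>
        (\<exists>\<F>. (\<forall>n. \<F> n \<in> fin_subsets (\<U> n)) \<and>
             (\<forall>A\<in>\<A>. \<forall>\<^sub>F n in sequentially. \<exists>U\<in>\<F> n. A \<subseteq> U)))"

lemma cofinite_selectionE:
  fixes \<U> :: "nat \<Rightarrow> 'a set set"
  assumes "cofinite_selection X \<A>" "\<And>n. \<U> n \<in> ideal_covers X \<A>"
  obtains \<F> where "\<And>n. \<F> n \<in> fin_subsets (\<U> n)"
    "\<And>A. A \<in> \<A> \<Longrightarrow> \<forall>\<^sub>F n in sequentially. \<exists>U\<in>\<F> n. A \<subseteq> U"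
proof -
  have "\<exists>\<F>. (\<forall>n. \<F> n \<in> fin_subsets (\<U> n)) \<and>
      (\<forall>A\<in>\<A>. \<forall>\<^sub>F n in sequentially. \<exists>U\<in>\<F> n. A \<subseteq> U)"
    using assms(1)[unfolded cofinite_selection_def, rule_format, of \<U>] assms(2) .
  with that show ?thesis
    by (elim exE conjE) auto
qed

lemma eventually_inj_subsequence:
  fixes h :: "nat \<Rightarrow> nat"
  assumes "inj h" "eventually P sequentially"
  shows "\<forall>\<^sub>F n in sequentially. P (h n)"
proof -
  have "finite (h -` {i. \<not> P i})"
    using assms by (intro finite_vimageI)
      (auto simp: eventually_cofinite simp flip: cofinite_eq_sequentially)
  then show ?thesis
    by (simp add: eventually_cofinite vimage_def flip: cofinite_eq_sequentially)
qed

context additive_ideal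
begin

text \<open>The common refinement of the first \<open>n\<close> covers keeps only the nonempty intersections, as an
  ideal cover consists of nonempty sets; no member of the ideal is lost by this.\<close>

lemma ideal_cover_common_refinement:
  fixes \<U> :: "nat \<Rightarrow> 'a set set"
  assumes "\<And>n. \<U> n \<in> ideal_covers X \<A>"
  shows "{W \<in> nt_opens X. \<forall>i\<le>n. \<exists>U\<in>\<U> i. W \<subseteq> U} \<in> ideal_covers X \<A>"
proof (rule ideal_coversI)
  fix A assume A: "A \<in> \<A>"
  then have "\<forall>i. \<exists>U. U \<in> \<U> i \<and> A \<subseteq> U"
    using assms unfolding ideal_covers_def by blast
  then obtain U where U: "\<And>i. U i \<in> \<U> i" "\<And>i. A \<subseteq> U i"
    by metis
  have nt: "U i \<in> nt_opens X" for i
    using assms[of i] U(1)[of i] by (auto simp: ideal_covers_def covers_def)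
  let ?W = "\<Inter>i\<in>{..n}. U i"
  have "openin X ?W"
    using nt by (intro openin_INT2) (auto simp: nt_opens_def)
  moreover have "A \<subseteq> ?W" "A \<noteq> {}"
    using U(2) A empty_notin by auto
  moreover have "?W \<noteq> topspace X"
  proof
    assume "?W = topspace X"
    then have "topspace X \<subseteq> U 0"
      by blast
    with nt[of 0] show False
      by (auto simp: nt_opens_def dest: openin_subset)
  qed
  ultimately have "?W \<in> nt_opens X"
    by (auto simp: nt_opens_def)
  moreover have "\<forall>i\<le>n. \<exists>U\<in>\<U> i. ?W \<subseteq> U"
    using U(1) by blast
  ultimately show "\<exists>W\<in>{W \<in> nt_opens X. \<forall>i\<le>n. \<exists>U\<in>\<U> i. W \<subseteq> U}. A \<subseteq> W"
    using \<open>A \<subseteq> ?W\<close> by blast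
qed blast

text \<open>Select from the common refinements. Only finitely many groups contain a set that was
  selected at a stage before \<open>n\<close>, so some group consists of sets inside elements of the cover
  with index \<open>n\<close>. Every infinite set of groups yields an ideal cover, hence each member of the
  ideal is handled by almost all of the groups used.\<close>

lemma cofinite_selection_of_S_fin_gp:
  assumes "S_fin (ideal_covers X \<A>) (gp (ideal_covers X \<A>))"
  shows "cofinite_selection X \<A>"
  unfolding cofinite_selection_def
proof (intro allI impI)
  fix \<U> :: "nat \<Rightarrow> 'a set set" assume \<U>: "\<forall>n. \<U> n \<in> ideal_covers X \<A>"
  define \<W> where "\<W> n = {W \<in> nt_opens X. \<forall>i\<le>n. \<exists>U\<in>\<U> i. W \<subseteq> U}" for n
  have "\<W> n \<in> ideal_covers X \<A>" for n
    unfolding \<W>_def using \<U> by (intro ideal_cover_common_refinement) auto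
  then obtain \<F> where \<F>: "\<And>n. \<F> n \<in> fin_subsets (\<W> n)"
    and "(\<Union>n. \<F> n) \<in> gp (ideal_covers X \<A>)"
    using assms unfolding S_fin_def by metis
  then obtain \<phi> :: "'a set \<Rightarrow> nat"
    where fin: "\<And>n. finite (\<phi> -` {n} \<inter> (\<Union>n. \<F> n))"
      and grp: "\<And>J. infinite J \<Longrightarrow> (\<Union>n\<in>J. \<phi> -` {n} \<inter> (\<Union>n. \<F> n)) \<in> ideal_covers X \<A>"
    unfolding gp_def groupable_def by blast
  define E where "E n = (\<Union>m<n. \<F> m)" for n
  have finE: "finite (E n)" for n
    using \<F> by (auto simp: E_def fin_subsets_def)
  obtain k :: "nat \<Rightarrow> nat" where k: "\<And>n. \<phi> -` {k n} \<inter> E n = {}" and k_mono: "\<And>n. k n < k (Suc n)"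
  proof -
    have *: "\<exists>j>b. \<phi> -` {j} \<inter> E n = {}" for n b :: nat
    proof -
      let ?j = "Suc (b + Max (insert 0 (\<phi> ` E n)))"
      have "\<phi> W < ?j" if "W \<in> E n" for W
        using Max_ge[of "insert 0 (\<phi> ` E n)" "\<phi> W"] that finE[of n]
        by (simp add: less_Suc_eq_le trans_le_add2)
      then have "\<phi> -` {?j} \<inter> E n = {}"
        by force
      then show ?thesis
        by (intro exI[of _ ?j]) auto
    qed
    have "\<exists>k. \<forall>n. \<phi> -` {k n} \<inter> E n = {} \<and> k n < k (Suc n)"
    proof (rule dependent_nat_choice)
      show "\<exists>j. \<phi> -` {j} \<inter> E 0 = {}"
        using *[of 0 0] by blast
      show "\<exists>j'. \<phi> -` {j'} \<inter> E (Suc n) = {} \<and> j < j'" for j n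
        using *[of j "Suc n"] by blast
    qed
    with that show ?thesis
      by blast
  qed
  have inj_k: "inj k"
    using k_mono by (simp add: strict_mono_Suc_iff strict_mono_imp_inj_on)
  define B where "B n = \<phi> -` {k n} \<inter> (\<Union>n. \<F> n)" for n
  have "\<exists>U. U \<in> \<U> n \<and> W \<subseteq> U" if W: "W \<in> B n" for n W
  proof -
    obtain m where m: "W \<in> \<F> m"
      using W by (auto simp: B_def)
    then have "\<not> m < n"
      using k[of n] W by (auto simp: B_def E_def)
    moreover have "W \<in> \<W> m"
      using m \<F>[of m] by (auto simp: fin_subsets_def)
    ultimately show ?thesis
      by (auto simp: \<W>_def not_less)
  qed
  from someI_ex[OF this]
  obtain f where f: "\<And>n W. W \<in> B n \<Longrightarrow> f n W \<in> \<U> n \<and> W \<subseteq> f n W"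
    by (rule that[of "\<lambda>n W. SOME U. U \<in> \<U> n \<and> W \<subseteq> U"])
  have "\<exists>U. U \<in> \<U> n" for n
    using \<F>[of n] by (auto simp: fin_subsets_def \<W>_def)
  then obtain u where u: "\<And>n. u n \<in> \<U> n"
    by metis
  \<comment> \<open>The group of index \<open>k n\<close> may be empty; the element \<open>u n\<close> keeps the selected set nonempty.\<close>
  define \<G> where "\<G> n = insert (u n) (f n ` B n)" for n
  have "\<G> n \<in> fin_subsets (\<U> n)" for n
    using f u fin by (auto simp: \<G>_def fin_subsets_def B_def)
  moreover have "\<forall>\<^sub>F n in sequentially. \<exists>U\<in>\<G> n. A \<subseteq> U" if A: "A \<in> \<A>" for A
  proof -
    have "finite {n. \<not> (\<exists>W\<in>B n. A \<subseteq> W)}" (is "finite ?N")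
    proof (rule ccontr)
      assume "infinite ?N"
      then have "infinite (k ` ?N)"
        using inj_k by (simp add: finite_image_iff inj_on_subset)
      then have "(\<Union>n\<in>k ` ?N. \<phi> -` {n} \<inter> (\<Union>n. \<F> n)) \<in> ideal_covers X \<A>"
        by (rule grp)
      then obtain n W where "n \<in> ?N" "W \<in> B n" "A \<subseteq> W"
        using A unfolding ideal_covers_def B_def by blast
      then show False
        by blast
    qed
    then have "\<forall>\<^sub>F n in sequentially. \<exists>W\<in>B n. A \<subseteq> W"
      by (simp add: eventually_cofinite flip: cofinite_eq_sequentially)
    then show ?thesis
      by (rule eventually_mono) (use f in \<open>fastforce simp: \<G>_def\<close>)
  qed
  ultimately show "\<exists>\<F>. (\<forall>n. \<F> n \<in> fin_subsets (\<U> n)) \<and>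
      (\<forall>A\<in>\<A>. \<forall>\<^sub>F n in sequentially. \<exists>U\<in>\<F> n. A \<subseteq> U)"
    by blast
qed

lemma countable_ideal_subcover:
  assumes "cofinite_selection X \<A>" "\<U> \<in> ideal_covers X \<A>"
  shows "\<exists>\<V>\<subseteq>\<U>. countable \<V> \<and> \<V> \<in> ideal_covers X \<A>"
proof -
  obtain \<F> :: "nat \<Rightarrow> 'a set set" where \<F>: "\<And>n. \<F> n \<in> fin_subsets \<U>"
    "\<And>A. A \<in> \<A> \<Longrightarrow> \<forall>\<^sub>F n in sequentially. \<exists>U\<in>\<F> n. A \<subseteq> U"
    using cofinite_selectionE[OF assms(1), of "\<lambda>_. \<U>"] assms(2) by blast
  have "(\<Union>n. \<F> n) \<in> ideal_covers X \<A>"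
  proof (rule ideal_coversI)
    show "(\<Union>n. \<F> n) \<subseteq> nt_opens X"
      using \<F>(1) assms(2) by (auto simp: fin_subsets_def ideal_covers_def covers_def)
    show "\<exists>U\<in>\<Union>n. \<F> n. A \<subseteq> U" if "A \<in> \<A>" for A
      using eventually_happens[OF \<F>(2)[OF that]] by auto
  qed
  moreover have "(\<Union>n. \<F> n) \<subseteq> \<U>"
    using \<F>(1) unfolding fin_subsets_def by blast
  moreover have "countable (\<Union>n. \<F> n)"
    using \<F>(1) by (simp add: fin_subsets_def countable_finite)
  ultimately show ?thesis
    by (intro exI[of _ "\<Union>n. \<F> n"] conjI)
qed

text \<open>A groupable cover needs disjoint groups, so the choice at stage \<open>n\<close> has to avoid the
  finite set \<open>G\<close> of all elements chosen before, which is not known in advance. Once the covers are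
  countable there are only countably many candidates for \<open>G\<close>, and cofinite selection can be
  applied at once to all covers \<open>\<V> n - G\<close>, indexed by the pairs \<open>(n, G)\<close>. The pairs that occur in
  the recursion have distinct first components, so almost all of them serve a given member of the
  ideal.\<close>

lemma S_fin_gp_of_cofinite_selection:
  assumes sel: "cofinite_selection X \<A>"
  shows "S_fin (ideal_covers X \<A>) (gp (ideal_covers X \<A>))"
  unfolding S_fin_def
proof (intro allI impI)
  fix \<U> :: "nat \<Rightarrow> 'a set set" assume "\<forall>n. \<U> n \<in> ideal_covers X \<A>"
  then have "\<forall>n. \<exists>\<V>. \<V> \<subseteq> \<U> n \<and> countable \<V> \<and> \<V> \<in> ideal_covers X \<A>"
    using countable_ideal_subcover[OF sel] by blast
  then obtain \<V> where \<V>: "\<And>n. \<V> n \<subseteq> \<U> n" "\<And>n. countable (\<V> n)"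
    "\<And>n. \<V> n \<in> ideal_covers X \<A>"
    by metis
  define I where "I = (UNIV :: nat set) \<times> {G. finite G \<and> G \<subseteq> (\<Union>n. \<V> n)}"
  have cI: "countable I"
    unfolding I_def using \<V>(2) by (intro countable_SIGMA countable_Collect_finite_subset) auto
  have inI: "(n, {}) \<in> I" for n
    by (simp add: I_def)
  then have "I \<noteq> {}"
    by blast
  let ?d = "from_nat_into I"
  have "finite (snd (?d i))" for i
    using from_nat_into[OF \<open>I \<noteq> {}\<close>, of i] by (simp add: I_def mem_Times_iff)
  then have "\<V> (fst (?d i)) - snd (?d i) \<in> ideal_covers X \<A>" for i
    by (rule ideal_covers_Diff_finite[OF \<V>(3)])
  then obtain F where F: "\<And>i. F i \<in> fin_subsets (\<V> (fst (?d i)) - snd (?d i))"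
    and F_ev: "\<And>A. A \<in> \<A> \<Longrightarrow> \<forall>\<^sub>F i in sequentially. \<exists>U\<in>F i. A \<subseteq> U"
    by (rule cofinite_selectionE[OF sel, of "\<lambda>i. \<V> (fst (?d i)) - snd (?d i)"]) (rule that)
  define G where "G = rec_nat {} (\<lambda>n G. G \<union> F (to_nat_on I (n, G)))"
  define \<F> where "\<F> n = F (to_nat_on I (n, G n))" for n
  have G_simps: "G 0 = {}" "G (Suc n) = G n \<union> \<F> n" for n
    by (simp_all add: G_def \<F>_def)
  have \<F>_if: "\<F> n \<in> fin_subsets (\<V> n - G n)" if "(n, G n) \<in> I" for n
    using F[of "to_nat_on I (n, G n)"] that cI by (simp add: \<F>_def)
  have GI: "(n, G n) \<in> I" for n
  proof (induction n)
    case 0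
    then show ?case
      using inI by (simp add: G_simps)
  next
    case (Suc n)
    then show ?case
      using \<F>_if[OF Suc] by (auto simp: I_def G_simps fin_subsets_def)
  qed
  have \<F>: "\<F> n \<in> fin_subsets (\<V> n - G n)" for n
    using \<F>_if GI by blast
  have G_eq: "G n = (\<Union>m<n. \<F> m)" for n
    by (induction n) (auto simp: G_simps less_Suc_eq)
  have disj: "m = n" if "U \<in> \<F> m" "U \<in> \<F> n" for U m n
  proof (rule ccontr)
    assume "m \<noteq> n"
    moreover have "U \<notin> G m" "U \<notin> G n"
      using that \<F>[of m] \<F>[of n] unfolding fin_subsets_def by blast+
    ultimately show False
      using that unfolding G_eq by (metis UN_I lessThan_iff nat_neq_iff)
  qed
  have "inj (\<lambda>n. to_nat_on I (n, G n))"
  proof (rule injI)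
    fix m n assume "to_nat_on I (m, G m) = to_nat_on I (n, G n)"
    then have "(m, G m) = (n, G n)"
      by (rule inj_onD[OF inj_on_to_nat_on[OF cI] _ GI GI])
    then show "m = n"
      by simp
  qed
  then have \<F>_ev: "\<forall>\<^sub>F n in sequentially. \<exists>U\<in>\<F> n. A \<subseteq> U" if "A \<in> \<A>" for A
    unfolding \<F>_def using F_ev[OF that]
    by (rule eventually_inj_subsequence[where P = "\<lambda>i. \<exists>U\<in>F i. A \<subseteq> U"])
  have cover: "(\<Union>n\<in>J. \<F> n) \<in> ideal_covers X \<A>" if "infinite J" for J
  proof (rule ideal_coversI)
    show "(\<Union>n\<in>J. \<F> n) \<subseteq> nt_opens X"
    proof (rule UN_least)
      fix n
      show "\<F> n \<subseteq> nt_opens X"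
        using \<F>[of n] \<V>(3)[of n] by (auto simp: fin_subsets_def ideal_covers_def covers_def)
    qed
    fix A assume "A \<in> \<A>"
    from \<F>_ev[OF this] obtain m where m: "\<And>n. n \<ge> m \<Longrightarrow> \<exists>U\<in>\<F> n. A \<subseteq> U"
      by (auto simp: eventually_sequentially)
    obtain n where "n \<in> J" "n \<ge> m"
      using \<open>infinite J\<close> by (auto simp: infinite_nat_iff_unbounded_le)
    with m show "\<exists>U\<in>\<Union>n\<in>J. \<F> n. A \<subseteq> U"
      by blast
  qed
  define \<phi> where "\<phi> U = (THE n. U \<in> \<F> n)" for U
  have "\<phi> U = n" if "U \<in> \<F> n" for U n
    unfolding \<phi>_def using that disj by blast
  then have fibre: "\<phi> -` {n} \<inter> (\<Union>n. \<F> n) = \<F> n" for n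
    by auto
  have "groupable (ideal_covers X \<A>) (\<Union>n. \<F> n)"
    unfolding groupable_def
  proof (intro exI[of _ \<phi>] conjI allI impI)
    show "finite (\<phi> -` {n} \<inter> (\<Union>n. \<F> n))" for n
      using \<F>[of n] by (simp add: fibre fin_subsets_def)
    show "(\<Union>n\<in>J. \<phi> -` {n} \<inter> (\<Union>n. \<F> n)) \<in> ideal_covers X \<A>" if "infinite J" for J
      using cover[OF that] by (simp only: fibre)
  qed
  with cover[of UNIV] have "(\<Union>n. \<F> n) \<in> gp (ideal_covers X \<A>)"
    by (simp add: gp_def)
  moreover have "\<F> n \<in> fin_subsets (\<U> n)" for n
    using \<F>[of n] \<V>(1)[of n] by (auto simp: fin_subsets_def)
  ultimately show "\<exists>\<F>. (\<forall>n. \<F> n \<in> fin_subsets (\<U> n)) \<and> (\<Union>n. \<F> n) \<in> gp (ideal_covers X \<A>)"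
    by blast
qed

theorem S_fin_gp_iff_cofinite_selection:
  "S_fin (ideal_covers X \<A>) (gp (ideal_covers X \<A>)) \<longleftrightarrow> cofinite_selection X \<A>"
  using S_fin_gp_of_cofinite_selection cofinite_selection_of_S_fin_gp by blast

end

section \<open>The hyperspace of a suitable operator\<close>

lemma topspace_hyper:
  assumes "adequate_context \<TT> \<AA> c" "X \<in> \<TT>"
  shows "topspace (hyper \<AA> c X) = c X ` \<AA> X"
proof -
  have "\<AA> X \<subseteq> compacts X" "inj_on (c X) (\<AA> X)"
    using assms by (auto simp: adequate_context_def ideal_of_compact_sets_def)
  then show ?thesis
    using homeomorphic_imp_surjective_map[OF homeomorphic_map_hyper[of \<AA> X c]]
    by (simp add: topspace_vietoris Int_absorb1)
qed

text \<open>Two members of the ideal form a finite set of points of the hyperspace, which belongs to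
  the ideal there; its union is in the ideal of \<open>X\<close> again. This excludes in particular that two
  members of the ideal cover \<open>X\<close>.\<close>

lemma additive_ideal_of_suitable:
  assumes ac: "adequate_context \<TT> \<AA> c" and su: "suitable \<TT> \<AA> c" and X: "X \<in> \<TT>"
  shows "additive_ideal X (\<AA> X)"
proof
  have id: "ideal_of_compact_sets X (\<AA> X)" and inj: "inj_on (c X) (\<AA> X)"
    and HT: "hyper \<AA> c X \<in> \<TT>"
    using ac X by (auto simp: adequate_context_def)
  show "fin_subsets (topspace X) \<subseteq> \<AA> X"
    using id by (simp add: ideal_of_compact_sets_def ideal_of_closed_sets_def)
  show "{} \<notin> \<AA> X"
    using id by (auto simp: ideal_of_compact_sets_def compacts_def)
  fix A B assume AB: "A \<in> \<AA> X" "B \<in> \<AA> X"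
  then have "{c X A, c X B} \<in> fin_subsets (topspace (hyper \<AA> c X))"
    by (simp add: fin_subsets_def topspace_hyper[OF ac X])
  moreover have "ideal_of_compact_sets (hyper \<AA> c X) (\<AA> (hyper \<AA> c X))"
    using ac HT by (auto simp: adequate_context_def)
  ultimately have "{c X A, c X B} \<in> \<AA> (hyper \<AA> c X)"
    by (auto simp: ideal_of_compact_sets_def ideal_of_closed_sets_def)
  then have "union_of_points \<AA> c X {c X A, c X B} \<in> \<AA> X"
    using su X by (auto simp: suitable_def)
  moreover have "union_of_points \<AA> c X {c X A, c X B} = A \<union> B"
    using AB inj by (auto simp: union_of_points_def dest: inj_onD)
  ultimately show "A \<union> B \<in> \<AA> X"
    by simp
qed

text \<open>A point \<open>K\<close> of the hyperspace lies in \<open>[U]\<close> just if \<open>K \<subseteq> U\<close>, so a Hurewicz selection for the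
  covers \<open>{[U] : U \<in> \<U> n}\<close> is a cofinite selection for the covers \<open>\<U> n\<close>.\<close>

lemma cofinite_selection_of_Hurewicz_hyper:
  assumes ac: "adequate_context \<TT> \<AA> c" and su: "suitable \<TT> \<AA> c" and X: "X \<in> \<TT>"
    and Hur: "Hurewicz_space (hyper \<AA> c X)"
  shows "cofinite_selection X (\<AA> X)"
  unfolding cofinite_selection_def
proof (intro allI impI)
  fix \<U> :: "nat \<Rightarrow> 'a set set" assume "\<forall>n. \<U> n \<in> ideal_covers X (\<AA> X)"
  then have "\<forall>n. below \<AA> c X ` \<U> n \<in> covers (hyper \<AA> c X)"
    using su X by (auto simp: suitable_def op_covers_def ideal_covers_def)
  then obtain \<F> where \<F>: "\<And>n. \<F> n \<in> fin_subsets (below \<AA> c X ` \<U> n)"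
    and \<F>_ev: "\<And>z. z \<in> topspace (hyper \<AA> c X) \<Longrightarrow> \<exists>m. \<forall>n\<ge>m. z \<in> \<Union>(\<F> n)"
    using Hur unfolding Hurewicz_space_def
    by (elim allE[of _ "\<lambda>n. below \<AA> c X ` \<U> n"]) blast
  have "\<forall>n. \<exists>\<G>. \<G> \<subseteq> \<U> n \<and> finite \<G> \<and> \<F> n = below \<AA> c X ` \<G>"
  proof
    fix n
    have "finite (\<F> n)" "\<F> n \<subseteq> below \<AA> c X ` \<U> n"
      using \<F>[of n] by (auto simp: fin_subsets_def)
    from finite_subset_image[OF this]
    show "\<exists>\<G>. \<G> \<subseteq> \<U> n \<and> finite \<G> \<and> \<F> n = below \<AA> c X ` \<G>" .
  qed
  then obtain \<G> where \<G>: "\<And>n. \<G> n \<subseteq> \<U> n" "\<And>n. finite (\<G> n)"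
    "\<And>n. \<F> n = below \<AA> c X ` \<G> n"
    by metis
  have "\<G> n \<in> fin_subsets (\<U> n)" for n
    using \<G> \<F>[of n] by (auto simp: fin_subsets_def)
  moreover have "\<forall>\<^sub>F n in sequentially. \<exists>U\<in>\<G> n. K \<subseteq> U" if K: "K \<in> \<AA> X" for K
  proof -
    obtain m where m: "\<And>n. n \<ge> m \<Longrightarrow> c X K \<in> \<Union>(\<F> n)"
      using \<F>_ev[of "c X K"] K topspace_hyper[OF ac X] by auto
    have "inj_on (c X) (\<AA> X)"
      using ac X by (auto simp: adequate_context_def)
    then have "\<exists>U\<in>\<G> n. K \<subseteq> U" if "n \<ge> m" for n
      using m[OF that] K by (auto simp: \<G>(3) below_def dest: inj_onD)
    then show ?thesis
      by (auto simp: eventually_sequentially)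
  qed
  ultimately show "\<exists>\<F>. (\<forall>n. \<F> n \<in> fin_subsets (\<U> n)) \<and>
      (\<forall>A\<in>\<AA> X. \<forall>\<^sub>F n in sequentially. \<exists>U\<in>\<F> n. A \<subseteq> U)"
    by blast
qed

text \<open>The sets \<open>V\<close> for which \<open>[V]\<close> refines an ideal cover of the hyperspace form an ideal cover of
  \<open>X\<close>. A member \<open>P\<close> of the ideal of the hyperspace lies in \<open>[V]\<close> as soon as \<open>V\<close> contains the union
  of \<open>P\<close>, and that union is in the ideal of \<open>X\<close>.\<close>

lemma cofinite_selection_hyper:
  assumes ac: "adequate_context \<TT> \<AA> c" and su: "suitable \<TT> \<AA> c" and X: "X \<in> \<TT>"
    and sel: "cofinite_selection X (\<AA> X)"
  shows "cofinite_selection (hyper \<AA> c X) (\<AA> (hyper \<AA> c X))"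
  unfolding cofinite_selection_def
proof (intro allI impI)
  let ?H = "hyper \<AA> c X"
  fix \<U> :: "nat \<Rightarrow> 'a set set" assume "\<forall>n. \<U> n \<in> ideal_covers ?H (\<AA> ?H)"
  then have "{V \<in> nt_opens X. \<exists>U\<in>\<U> n. below \<AA> c X V \<subseteq> U} \<in> ideal_covers X (\<AA> X)" for n
    using su X by (auto simp: suitable_def op_covers_def)
  then obtain \<F> where \<F>: "\<And>n. \<F> n \<in> fin_subsets {V \<in> nt_opens X. \<exists>U\<in>\<U> n. below \<AA> c X V \<subseteq> U}"
    and \<F>_ev: "\<And>A. A \<in> \<AA> X \<Longrightarrow> \<forall>\<^sub>F n in sequentially. \<exists>V\<in>\<F> n. A \<subseteq> V"
    by (rule cofinite_selectionE[OF sel,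
          of "\<lambda>n. {V \<in> nt_opens X. \<exists>U\<in>\<U> n. below \<AA> c X V \<subseteq> U}"]) (rule that)
  have "\<exists>U. U \<in> \<U> n \<and> below \<AA> c X V \<subseteq> U" if "V \<in> \<F> n" for n V
    using that \<F>[of n] by (auto simp: fin_subsets_def)
  from someI_ex[OF this]
  obtain f where f: "\<And>n V. V \<in> \<F> n \<Longrightarrow> f n V \<in> \<U> n \<and> below \<AA> c X V \<subseteq> f n V"
    by (rule that[of "\<lambda>n V. SOME U. U \<in> \<U> n \<and> below \<AA> c X V \<subseteq> U"])
  have "f n ` \<F> n \<in> fin_subsets (\<U> n)" for n
    using \<F>[of n] f[of _ n] by (auto simp: fin_subsets_def)
  moreover have "\<forall>\<^sub>F n in sequentially. \<exists>U\<in>f n ` \<F> n. P \<subseteq> U" if P: "P \<in> \<AA> ?H" for P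
  proof -
    have "?H \<in> \<TT>"
      using ac X by (auto simp: adequate_context_def)
    then have "compactin ?H P"
      using ac P by (auto simp: adequate_context_def ideal_of_compact_sets_def compacts_def)
    then have "P \<subseteq> c X ` \<AA> X"
      using compactin_subset_topspace topspace_hyper[OF ac X] by blast
    then have le: "P \<subseteq> below \<AA> c X V" if "union_of_points \<AA> c X P \<subseteq> V" for V
      using that by (fastforce simp: below_def union_of_points_def)
    have "union_of_points \<AA> c X P \<in> \<AA> X"
      using su X P by (auto simp: suitable_def)
    from \<F>_ev[OF this] show ?thesis
    proof (rule eventually_mono)
      fix n assume "\<exists>V\<in>\<F> n. union_of_points \<AA> c X P \<subseteq> V"
      then obtain V where "V \<in> \<F> n" "P \<subseteq> below \<AA> c X V"
        using le by blast
      with f show "\<exists>U\<in>f n ` \<F> n. P \<subseteq> U"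
        by blast
    qed
  qed
  ultimately show "\<exists>\<F>. (\<forall>n. \<F> n \<in> fin_subsets (\<U> n)) \<and>
      (\<forall>A\<in>\<AA> ?H. \<forall>\<^sub>F n in sequentially. \<exists>U\<in>\<F> n. A \<subseteq> U)"
    by (intro exI[of _ "\<lambda>n. f n ` \<F> n"] conjI allI ballI)
qed

theorem theorem25:
  fixes \<TT> :: "'u topology set"
    and \<AA> :: "'u topology \<Rightarrow> 'u set set"
    and c :: "'u topology \<Rightarrow> 'u set \<Rightarrow> 'u"
    and X :: "'u topology"
  assumes "adequate_context \<TT> \<AA> c"
    and "suitable \<TT> \<AA> c"
    and "X \<in> \<TT>"
  shows "(Hurewicz_space (hyper \<AA> c X)
            \<longleftrightarrow> models_S_fin (hyper \<AA> c X) (op_covers \<AA>) (op_covers_gp \<AA>)) \<and>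
         (models_S_fin (hyper \<AA> c X) (op_covers \<AA>) (op_covers_gp \<AA>)
            \<longleftrightarrow> models_S_fin X (op_covers \<AA>) (op_covers_gp \<AA>)) \<and>
         (models_S_fin X (op_covers \<AA>) (op_covers_gp \<AA>)
            \<longleftrightarrow> models_S_fin X (op_covers \<AA>) (op_covers \<AA>) \<and>
                op_covers_gp \<AA> X = op_covers \<AA> X \<inter> ctbl_subsets (nt_opens X))"
proof -
  let ?H = "hyper \<AA> c X"
  have HT: "?H \<in> \<TT>"
    using assms by (auto simp: adequate_context_def)
  interpret X: additive_ideal X "\<AA> X"
    by (rule additive_ideal_of_suitable[OF assms])
  interpret H: additive_ideal ?H "\<AA> ?H"
    by (rule additive_ideal_of_suitable[OF assms(1,2) HT])
  have ii: "models_S_fin ?H (op_covers \<AA>) (op_covers_gp \<AA>) \<longleftrightarrow> cofinite_selection ?H (\<AA> ?H)"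
    by (simp add: models_S_fin_def op_covers_def op_covers_gp_def H.S_fin_gp_iff_cofinite_selection)
  have iii: "models_S_fin X (op_covers \<AA>) (op_covers_gp \<AA>) \<longleftrightarrow> cofinite_selection X (\<AA> X)"
    by (simp add: models_S_fin_def op_covers_def op_covers_gp_def X.S_fin_gp_iff_cofinite_selection)
  have ii_i: "Hurewicz_space ?H" if "models_S_fin ?H (op_covers \<AA>) (op_covers_gp \<AA>)"
    using assms(2) HT that by (simp add: suitable_def)
  have i_iii: "cofinite_selection X (\<AA> X)" if "Hurewicz_space ?H"
    using cofinite_selection_of_Hurewicz_hyper[OF assms that] .
  have iii_ii: "cofinite_selection ?H (\<AA> ?H)" if "cofinite_selection X (\<AA> X)"
    using cofinite_selection_hyper[OF assms that] .
  have iii_iv: "models_S_fin X (op_covers \<AA>) (op_covers_gp \<AA>) \<longleftrightarrow>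
      models_S_fin X (op_covers \<AA>) (op_covers \<AA>) \<and>
      op_covers_gp \<AA> X = op_covers \<AA> X \<inter> ctbl_subsets (nt_opens X)"
    unfolding models_S_fin_def op_covers_def op_covers_gp_def
    by (rule X.S_fin_gp_iff_countable_groupable)
  have "Hurewicz_space ?H \<longleftrightarrow> models_S_fin ?H (op_covers \<AA>) (op_covers_gp \<AA>)"
    using ii ii_i i_iii iii_ii by blast
  moreover have "models_S_fin ?H (op_covers \<AA>) (op_covers_gp \<AA>) \<longleftrightarrow>
      models_S_fin X (op_covers \<AA>) (op_covers_gp \<AA>)"
    using ii iii ii_i i_iii iii_ii by blast
  ultimately show ?thesis
    using iii_iv by (intro conjI)
qed

end
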